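(* For every integer $n\ge0$, $$c\phi_{10}(2n+1)\equiv0\pmod4,\qquad c\phi_{10}(5n+r)\equiv0\pmod{5^2}\ \ (1\le r\le4),\qquad c\phi_{10}(25n+15)\equiv0\pmod5.$$
   Context: A $k$-colored generalized Frobenius symbol is a two-row array with $d\ge 0$ columns whose entries are colored nonnegative integers $\ell_c$ ($\ell\ge 0$, color $c\in\{1,\dots,k\}$), each row strictly decreasing with respect to the total order $0_1\prec 0_2\prec\cdots\prec 0_k\prec 1_1\prec\cdots\prec 1_k\prec 2_1\prec\cdots$. It is a $k$-colored generalized Frobenius partition of $n=d+\sum(\text{integer values of all entries})$, and $c\phi_k(n)$ is the number of such partitions of $n$. *)

theory Defs
  imports "HOL-Number_Theory.Cong"
begin

text \<open>A pair (l, c) encodes the coloured integer \<open>l\<^sub>c\<close>.\<close>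

type_synonym colored = "nat \<times> nat"

definition colored_less :: "colored \<Rightarrow> colored \<Rightarrow> bool" where
  "colored_less x y \<longleftrightarrow> fst x < fst y \<or> (fst x = fst y \<and> snd x < snd y)"

definition frobenius_row :: "nat \<Rightarrow> colored list \<Rightarrow> bool" where
  "frobenius_row k xs \<longleftrightarrow>
     (\<forall>x \<in> set xs. snd x \<in> {1..k}) \<and> sorted_wrt (\<lambda>x y. colored_less y x) xs"

text \<open>The two components of a symbol are its top and its bottom row.\<close>

definition frobenius_symbol :: "nat \<Rightarrow> colored list \<times> colored list \<Rightarrow> bool" where
  "frobenius_symbol k s \<longleftrightarrow>
     length (fst s) = length (snd s) \<and> frobenius_row k (fst s) \<and> frobenius_row k (snd s)"

definition symbol_weight :: "colored list \<times> colored list \<Rightarrow> nat" where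
  "symbol_weight s =
     length (fst s) + sum_list (map fst (fst s)) + sum_list (map fst (snd s))"

definition frobenius_partitions :: "nat \<Rightarrow> nat \<Rightarrow> (colored list \<times> colored list) set" where
  "frobenius_partitions k n = {s. frobenius_symbol k s \<and> symbol_weight s = n}"

definition cphi :: "nat \<Rightarrow> nat \<Rightarrow> nat" where
  "cphi k n = card (frobenius_partitions k n)"

lemma finite_frobenius_partitions: "finite (frobenius_partitions k n)"
proof (rule finite_subset)
  let ?R = "{xs. set xs \<subseteq> {0..n} \<times> {1..k} \<and> length xs \<le> n}"
  show "finite (?R \<times> ?R)"
    by (intro finite_cartesian_product finite_lists_length_le) simp_all
  have bound: "fst x \<le> sum_list (map fst xs)" if "x \<in> set xs" for x and xs :: "colored list"
    using that by (intro member_le_sum_list) simp_all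
  show "frobenius_partitions k n \<subseteq> ?R \<times> ?R"
    unfolding frobenius_partitions_def frobenius_symbol_def frobenius_row_def symbol_weight_def
    by (force dest: bound)
qed

end

theory Submission
  imports Defs "HOL-Computational_Algebra.Polynomial" "HOL-Computational_Algebra.Formal_Power_Series"
    "HOL-Library.Product_Lexorder"
begin

text \<open>
  A row of a \<open>k\<close>-coloured symbol is a finite set of coloured integers, so rows of length \<open>d\<close> are
  enumerated by the coefficient \<open>a\<^sub>d(q)\<close> of \<open>z\<^sup>d\<close> in \<open>\<Prod>i. (1 + z q\<^sup>i)\<^sup>k\<close>, and \<open>c\<phi>\<^sub>k(n)\<close> is the
  coefficient of \<open>q\<^sup>n\<close> in \<open>\<Sum>d. q\<^sup>d a\<^sub>d(q)\<^sup>2\<close>.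

  For a prime \<open>p\<close> we have \<open>(1 + x)\<^sup>p = 1 + x\<^sup>p + p r(x)\<close>, where \<open>r\<close> only has terms of degree strictly
  between \<open>0\<close> and \<open>p\<close>. Hence for \<open>p k\<close> colours \<open>a\<^sub>d\<close> is divisible by \<open>p\<close> if \<open>p\<close> does not divide \<open>d\<close>,
  and otherwise is congruent modulo \<open>p\<^sup>2\<close> to the corresponding series for \<open>k\<close> colours in \<open>q\<^sup>p\<close>. Thus
  \<open>c\<phi>\<^bsub>pk\<^esub>(n)\<close> is congruent modulo \<open>p\<^sup>2\<close> to \<open>c\<phi>\<^sub>k(n/p)\<close> or to \<open>0\<close>, according to whether \<open>p\<close> divides
  \<open>n\<close>. This gives the first two congruences and reduces the third to Andrews' congruence
  \<open>c\<phi>\<^sub>2(5n+3) \<equiv> 0 (mod 5)\<close>.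

  For the latter, let \<open>E = \<Prod>i\<ge>1. (1 - q\<^sup>i)\<close>. Jacobi's triple product gives
  \<open>E\<^sup>2 \<Sum>n. c\<phi>\<^sub>2(n) q\<^sup>n = \<Sum>y. q\<^bsup>y\<^sup>2\<^esup>\<close>, and its \<open>z\<close>-derivative at \<open>z = -1\<close> expands \<open>E\<^sup>3\<close> in the terms
  \<open>\<plusminus>(2j+1) q\<^bsup>j(j+1)/2\<^esup>\<close>. An exponent \<open>i = y\<^sup>2 + j(j+1)/2\<close> satisfies
  \<open>8i + 1 = (2j+1)\<^sup>2 + 8y\<^sup>2\<close>, so \<open>i \<equiv> 3 (mod 5)\<close> forces \<open>5\<close> to divide \<open>2j+1\<close>, while \<open>E\<^sup>5\<close> is a series
  in \<open>q\<^sup>5\<close> modulo \<open>5\<close>.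
\<close>

unbundle fps_syntax

subsection \<open>Generating functions for coloured Frobenius partitions\<close>

text \<open>
  The polynomial variable \<open>z\<close> marks the length of a row and the power series variable \<open>q\<close> its
  sum; truncating to entries below \<open>N\<close> keeps everything polynomial in \<open>z\<close>. The parameter \<open>e\<close>
  substitutes \<open>z\<^sup>e\<close> and \<open>q\<^sup>e\<close> for \<open>z\<close> and \<open>q\<close>.
\<close>

definition row_gf :: "nat \<Rightarrow> nat \<Rightarrow> nat \<Rightarrow> int fps poly" where
  "row_gf e N k = (\<Prod>i<N. (1 + monom (fps_X ^ (e * i)) e) ^ k)"

text \<open>Reversed, a row is strictly increasing in the lexicographic product order, so
  \<open>sorted_list_of_set\<close> recovers it from its set of entries.\<close>

lemma frobenius_row_iff:
  "frobenius_row k xs \<longleftrightarrow> set xs \<subseteq> UNIV \<times> {1..k} \<and> sorted_wrt (<) (rev xs)"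
proof -
  have "colored_less = (<)"
    by (intro ext) (simp add: colored_less_def less_prod_def')
  then show ?thesis
    by (auto simp: frobenius_row_def sorted_wrt_rev)
qed

definition set_pairs :: "nat \<Rightarrow> nat \<Rightarrow> nat \<Rightarrow> (colored set \<times> colored set) set" where
  "set_pairs N k n =
     {(S, T). S \<subseteq> {..<N} \<times> {1..k} \<and> T \<subseteq> {..<N} \<times> {1..k} \<and> card S = card T \<and>
        card S + sum fst S + sum fst T = n}"

text \<open>No entry exceeds the weight n, so cutting the entries off at N > n loses
  nothing.\<close>

lemma cphi_eq_card_set_pairs:
  assumes "n < N"
  shows "cphi k n = card (set_pairs N k n)"
proof -
  have row: "length xs = card (set xs)" "sum_list (map fst xs) = sum fst (set xs)"
    if "frobenius_row k xs" for xs
  proof -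
    have "distinct xs" using that by (simp add: frobenius_row_iff strict_sorted_iff)
    then show "length xs = card (set xs)" "sum_list (map fst xs) = sum fst (set xs)"
      by (simp_all add: distinct_card sum_list_distinct_conv_sum_set)
  qed
  have "bij_betw (map_prod set set) (frobenius_partitions k n) (set_pairs N k n)"
  proof (rule bij_betwI[where g = "map_prod (rev \<circ> sorted_list_of_set) (rev \<circ> sorted_list_of_set)"])
    show "map_prod set set \<in> frobenius_partitions k n \<rightarrow> set_pairs N k n"
    proof
      fix s assume s: "s \<in> frobenius_partitions k n"
      obtain xs ys where [simp]: "s = (xs, ys)" by (cases s)
      have r: "frobenius_row k xs" "frobenius_row k ys" "length xs = length ys"
        "length xs + sum_list (map fst xs) + sum_list (map fst ys) = n"
        using s by (auto simp: frobenius_partitions_def frobenius_symbol_def symbol_weight_def)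
      have "fst x < N" if "x \<in> set xs \<union> set ys" for x
      proof -
        have "fst x \<le> sum_list (map fst xs) \<or> fst x \<le> sum_list (map fst ys)"
          using that by (auto intro!: member_le_sum_list)
        then show ?thesis using r(4) assms by linarith
      qed
      moreover have "set xs \<subseteq> UNIV \<times> {1..k}" "set ys \<subseteq> UNIV \<times> {1..k}"
        using r(1,2) by (simp_all add: frobenius_row_iff)
      ultimately show "map_prod set set s \<in> set_pairs N k n"
        using r row[OF r(1)] row[OF r(2)] by (fastforce simp: set_pairs_def)
    qed
    show "map_prod (rev \<circ> sorted_list_of_set) (rev \<circ> sorted_list_of_set)
            \<in> set_pairs N k n \<rightarrow> frobenius_partitions k n"
    proof
      fix s assume s: "s \<in> set_pairs N k n"
      obtain S T where [simp]: "s = (S, T)" by (cases s)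
      have r: "S \<subseteq> {..<N} \<times> {1..k}" "T \<subseteq> {..<N} \<times> {1..k}" "card S = card T"
        "card S + sum fst S + sum fst T = n"
        using s by (auto simp: set_pairs_def)
      have fin: "finite S" "finite T"
        using r(1,2)[THEN finite_subset] by simp_all
      have "frobenius_row k (rev (sorted_list_of_set S))" "frobenius_row k (rev (sorted_list_of_set T))"
        using r(1,2) fin by (auto simp: frobenius_row_iff)
      from this[THEN row(2)] this show "map_prod (rev \<circ> sorted_list_of_set) (rev \<circ> sorted_list_of_set) s
          \<in> frobenius_partitions k n"
        using r(3,4) fin
        by (simp add: frobenius_partitions_def frobenius_symbol_def symbol_weight_def)
    qed
    show "map_prod (rev \<circ> sorted_list_of_set) (rev \<circ> sorted_list_of_set) (map_prod set set s) = s"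
      if "s \<in> frobenius_partitions k n" for s
    proof -
      have "rev (sorted_list_of_set (set xs)) = xs" if "frobenius_row k xs" for xs
        using sorted_list_of_set.idem_if_sorted_distinct[of "rev xs"] that
        by (simp add: frobenius_row_iff strict_sorted_iff)
      with that show ?thesis
        by (cases s) (auto simp: frobenius_partitions_def frobenius_symbol_def)
    qed
    show "map_prod set set (map_prod (rev \<circ> sorted_list_of_set) (rev \<circ> sorted_list_of_set) s) = s"
      if "s \<in> set_pairs N k n" for s
    proof -
      obtain S T where [simp]: "s = (S, T)" by (cases s)
      have "finite S" "finite T"
        using that finite_subset[of _ "{..<N} \<times> {1..k}"] by (simp_all add: set_pairs_def)
      then show ?thesis by simp
    qed
  qed
  then show ?thesis
    unfolding cphi_def by (rule bij_betw_same_card)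
qed

lemma row_gf_expand:
  "row_gf e N k =
     (\<Sum>S\<in>Pow ({..<N} \<times> {1..k}). monom (fps_X ^ (e * sum fst S)) (e * card S))"
proof -
  have *: "(\<Prod>x\<in>S. monom (fps_X ^ (e * fst x) :: int fps) e) = monom (fps_X ^ (e * sum fst S)) (e * card S)"
    if "finite S" for S :: "colored set"
    using that
    by induction (simp_all add: mult_monom algebra_simps power_add)
  have "row_gf e N k = (\<Prod>x\<in>{..<N} \<times> {1..k}. monom (fps_X ^ (e * fst x)) e + 1)"
    using prod.cartesian_product[of "\<lambda>i _. monom (fps_X ^ (e * i) :: int fps) e + 1" "{1..k}" "{..<N}"]
    by (simp add: row_gf_def add.commute case_prod_unfold)
  also have "\<dots> = (\<Sum>S\<in>Pow ({..<N} \<times> {1..k}). \<Prod>x\<in>S. monom (fps_X ^ (e * fst x)) e)"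
    by (subst prod_add) auto
  also have "\<dots> = (\<Sum>S\<in>Pow ({..<N} \<times> {1..k}). monom (fps_X ^ (e * sum fst S)) (e * card S))"
    by (intro sum.cong refl *) (simp add: finite_subset[of _ "{..<N} \<times> {1..k}"])
  finally show ?thesis .
qed

text \<open>Squaring a coefficient pairs two rows of equal length, and \<open>fps_X ^ d\<close> adds
  that length to the weight, all scaled by e. Pairs counted at n have d at most n, so summing up to
  M suffices.\<close>

lemma cphi_generating_function:
  assumes "e > 0" "n < N" "n \<le> M"
  shows "(\<Sum>d\<le>M. fps_X ^ d * coeff (row_gf e N k) d ^ 2) $ n =
         int (if e dvd n then cphi k (n div e) else 0)"
proof -
  let ?P = "Pow ({..<N} \<times> {1..k})"
  have "(\<Sum>d\<le>M. fps_X ^ d * coeff (row_gf e N k) d ^ 2) =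
      (\<Sum>d\<le>M. fps_X ^ d * (\<Sum>(S, T)\<in>?P \<times> ?P.
         if d = e * card S \<and> d = e * card T then fps_X ^ (e * sum fst S + e * sum fst T) else 0))"
    unfolding row_gf_expand power2_eq_square coeff_sum sum_product sum.cartesian_product
    by (intro sum.cong arg_cong2[where f = "(*)"] refl) (auto simp: power_add)
  also have "\<dots> = (\<Sum>d\<le>M. \<Sum>(S, T)\<in>?P \<times> ?P.
         if d = e * card S \<and> card S = card T then fps_X ^ (e * (card S + sum fst S + sum fst T)) else 0)"
    unfolding sum_distrib_left [where r = "fps_X ^ d" for d]
    by (intro sum.cong refl) (use assms(1) in \<open>auto simp: power_add distrib_left mult.assoc\<close>)
  finally have "(\<Sum>d\<le>M. fps_X ^ d * coeff (row_gf e N k) d ^ 2) $ n = (\<Sum>d\<le>M. \<Sum>(S, T)\<in>?P \<times> ?P.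
         if d = e * card S \<and> card S = card T \<and> e * (card S + sum fst S + sum fst T) = n then 1 else 0)"
    by (simp only: fps_sum_nth) (intro sum.cong refl, auto)
  also have "\<dots> = (\<Sum>(S, T)\<in>?P \<times> ?P. \<Sum>d\<le>M.
         if d = e * card S \<and> card S = card T \<and> e * (card S + sum fst S + sum fst T) = n then 1 else 0)"
    unfolding case_prod_unfold by (rule sum.swap)
  also have "\<dots> = (\<Sum>(S, T)\<in>?P \<times> ?P.
         if card S = card T \<and> e * (card S + sum fst S + sum fst T) = n then 1 else 0)"
  proof (intro sum.cong refl, clarify)
    fix S T :: "colored set"
    show "(\<Sum>d\<le>M. if d = e * card S \<and> card S = card T \<and> e * (card S + sum fst S + sum fst T) = n
            then 1 else 0) =
          (if card S = card T \<and> e * (card S + sum fst S + sum fst T) = n then 1 else (0 :: int))"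
    proof (cases "card S = card T \<and> e * (card S + sum fst S + sum fst T) = n")
      case True
      then have "e * card S \<le> M" using assms(3) by (auto simp: algebra_simps)
      with True show ?thesis by simp
    next
      case False
      then show ?thesis by (intro trans[OF sum.neutral]) auto
    qed
  qed
  also have "\<dots> = (\<Sum>x\<in>{x \<in> ?P \<times> ?P. case x of (S, T) \<Rightarrow>
         card S = card T \<and> e * (card S + sum fst S + sum fst T) = n}. 1)"
    unfolding case_prod_unfold by (rule sum.inter_filter [symmetric]) simp
  also have "\<dots> = int (card {x \<in> ?P \<times> ?P. case x of (S, T) \<Rightarrow>
         card S = card T \<and> e * (card S + sum fst S + sum fst T) = n})"
    by simp
  also have "{x \<in> ?P \<times> ?P. case x of (S, T) \<Rightarrow>
         card S = card T \<and> e * (card S + sum fst S + sum fst T) = n} =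
      (if e dvd n then set_pairs N k (n div e) else {})"
    using assms(1) by (auto simp: set_pairs_def)
  also have "int (card \<dots>) = int (if e dvd n then cphi k (n div e) else 0)"
    using assms(2) cphi_eq_card_set_pairs[of "n div e" N k]
    by (simp add: div_le_dividend[THEN le_less_trans])
  finally show ?thesis .
qed

subsection \<open>Reduction modulo the square of a prime\<close>

text \<open>
  The first-order error \<open>p U\<close> lives on \<open>z\<close>-degrees prime to \<open>p\<close>, the main term \<open>g\<close> on multiples
  of \<open>p\<close>; so squaring a coefficient of \<open>f\<close> never produces a cross term modulo \<open>p\<^sup>2\<close>.
\<close>

definition prime_approx :: "nat \<Rightarrow> int fps poly \<Rightarrow> int fps poly \<Rightarrow> bool" where
  "prime_approx p f g \<longleftrightarrow>
     (\<forall>d. \<not> p dvd d \<longrightarrow> coeff g d = 0) \<and>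
     (\<exists>U V. f = g + of_nat p * U + of_nat (p\<^sup>2) * V \<and> (\<forall>d. p dvd d \<longrightarrow> coeff U d = 0))"

lemma prime_approx_1: "prime_approx p 1 1"
proof -
  have "1 = 1 + of_nat p * 0 + of_nat (p\<^sup>2) * (0 :: int fps poly)"
    by simp
  moreover have "\<forall>d. \<not> p dvd d \<longrightarrow> coeff (1 :: int fps poly) d = 0"
    by (auto simp: coeff_1 intro!: Nat.gr0I)
  ultimately show ?thesis
    unfolding prime_approx_def by (metis coeff_0)
qed

text \<open>The new first-order error \<open>U * g' + g * U'\<close> again avoids multiples of p,
  because shifting a degree by a multiple of p preserves divisibility by p; \<open>U * U'\<close>
  already carries the factor p^2.\<close>

lemma prime_approx_mult:
  assumes "prime_approx p f g" "prime_approx p f' g'"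
  shows "prime_approx p (f * f') (g * g')"
proof -
  obtain U V where f: "f = g + of_nat p * U + of_nat (p\<^sup>2) * V" "\<And>d. p dvd d \<Longrightarrow> coeff U d = 0"
      and g: "\<And>d. \<not> p dvd d \<Longrightarrow> coeff g d = 0"
    using assms(1) unfolding prime_approx_def by metis
  obtain U' V' where f': "f' = g' + of_nat p * U' + of_nat (p\<^sup>2) * V'"
        "\<And>d. p dvd d \<Longrightarrow> coeff U' d = 0"
      and g': "\<And>d. \<not> p dvd d \<Longrightarrow> coeff g' d = 0"
    using assms(2) unfolding prime_approx_def by metis
  have "coeff (g * g') d = 0" if "\<not> p dvd d" for d
    unfolding coeff_mult
  proof (intro sum.neutral ballI)
    fix i assume "i \<in> {..d}"
    then have "\<not> p dvd i \<or> \<not> p dvd d - i"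
      using that dvd_add[of p i "d - i"] by auto
    then show "coeff g i * coeff g' (d - i) = 0"
      using g g' by auto
  qed
  moreover have "coeff (U * g' + g * U') d = 0" if "p dvd d" for d
  proof -
    have "coeff U i * coeff g' (d - i) = 0" "coeff g i * coeff U' (d - i) = 0" if "i \<le> d" for i
    proof -
      have "p dvd i \<longleftrightarrow> p dvd d - i"
        using \<open>p dvd d\<close> that by (metis dvd_add_right_iff dvd_diff_nat le_add_diff_inverse2)
      then show "coeff U i * coeff g' (d - i) = 0" "coeff g i * coeff U' (d - i) = 0"
        using f(2) g g' f'(2) by (metis mult_eq_0_iff)+
    qed
    then show ?thesis by (simp add: coeff_mult del: mult_eq_0_iff)
  qed
  moreover have "f * f' = g * g' + of_nat p * (U * g' + g * U') +
      of_nat (p\<^sup>2) * (g * V' + V * g' + U * U' + of_nat p * (U * V' + V * U') + of_nat (p\<^sup>2) * V * V')"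
    unfolding f(1) f'(1) of_nat_power by algebra
  ultimately show ?thesis
    unfolding prime_approx_def by blast
qed

lemma prime_approx_power: "prime_approx p f g \<Longrightarrow> prime_approx p (f ^ n) (g ^ n)"
  by (induction n) (simp_all add: prime_approx_1 prime_approx_mult)

lemma prime_approx_prod:
  "(\<And>i. i \<in> A \<Longrightarrow> prime_approx p (f i) (g i)) \<Longrightarrow> prime_approx p (prod f A) (prod g A)"
  by (induction A rule: infinite_finite_induct) (simp_all add: prime_approx_1 prime_approx_mult)

lemma prime_approx_binomial:
  assumes "prime p"
  shows "prime_approx p ((1 + monom c 1) ^ p) (1 + monom (c ^ p) p)"
proof -
  define U where "U = (\<Sum>k\<in>{0<..<p}. of_nat ((p choose k) div p) * monom (c ^ k) k)"
  have p: "p > 0" using assms by (simp add: prime_gt_0_nat)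
  have "(1 + monom c 1) ^ p = (\<Sum>k\<le>p. of_nat (p choose k) * monom (c ^ k) k)"
    using binomial_ring[of "monom c 1" 1 p] by (simp add: add.commute monom_power)
  also have "{..p} = insert 0 (insert p {0<..<p})"
    using p by auto
  also have "(\<Sum>k\<in>\<dots>. of_nat (p choose k) * monom (c ^ k) k) =
      1 + monom (c ^ p) p + (\<Sum>k\<in>{0<..<p}. of_nat (p choose k) * monom (c ^ k) k)"
    using p by (simp add: monom_0)
  also have "(\<Sum>k\<in>{0<..<p}. of_nat (p choose k) * monom (c ^ k) k) = of_nat p * U"
    unfolding U_def sum_distrib_left
  proof (intro sum.cong refl)
    fix k assume "k \<in> {0<..<p}"
    then have "p choose k = p * ((p choose k) div p)"
      using assms by (simp add: dvd_choose_prime)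
    then show "of_nat (p choose k) * monom (c ^ k) k =
        of_nat p * (of_nat ((p choose k) div p) * monom (c ^ k) k)"
      by (metis mult.assoc of_nat_mult)
  qed
  finally have "(1 + monom c 1) ^ p = 1 + monom (c ^ p) p + of_nat p * U + of_nat (p\<^sup>2) * 0"
    by simp
  moreover have "coeff U d = 0" if "p dvd d" for d
    unfolding U_def coeff_sum of_nat_mult_conv_smult
    using that by (intro sum.neutral) (auto dest: dvd_imp_le)
  moreover have "coeff (1 + monom (c ^ p) p) d = 0" if "\<not> p dvd d" for d
    using that by (auto simp: coeff_1)
  ultimately show ?thesis
    unfolding prime_approx_def by blast
qed

lemma cphi_prime_mult_cong:
  assumes "prime p"
  shows "[cphi (p * k) n = (if p dvd n then cphi k (n div p) else 0)] (mod p\<^sup>2)"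
proof -
  let ?f = "row_gf 1 (Suc n) (p * k)" and ?g = "row_gf p (Suc n) k"
  have "prime_approx p ?f ?g"
    unfolding row_gf_def power_mult
    using prime_approx_binomial[OF assms, of "fps_X ^ i" for i]
    by (intro prime_approx_prod prime_approx_power) (simp add: power_mult [symmetric] mult.commute)
  then obtain U V where f: "?f = ?g + of_nat p * U + of_nat (p\<^sup>2) * V"
      and U: "\<And>d. p dvd d \<Longrightarrow> coeff U d = 0" and g: "\<And>d. \<not> p dvd d \<Longrightarrow> coeff ?g d = 0"
    unfolding prime_approx_def by metis
  have "\<exists>w. coeff ?f d ^ 2 = coeff ?g d ^ 2 + of_nat (p\<^sup>2) * w" for d
  proof (cases "p dvd d")
    case True
    then have "coeff ?f d = coeff ?g d + of_nat (p\<^sup>2) * coeff V d"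
      unfolding f using U by (simp add: of_nat_mult_conv_smult del: of_nat_power)
    then have "coeff ?f d ^ 2 =
        coeff ?g d ^ 2 + of_nat (p\<^sup>2) * (2 * coeff ?g d * coeff V d + of_nat (p\<^sup>2) * coeff V d ^ 2)"
      by algebra
    then show ?thesis by blast
  next
    case False
    then have "coeff ?f d = of_nat p * coeff U d + of_nat (p\<^sup>2) * coeff V d"
      unfolding f using g by (simp add: of_nat_mult_conv_smult del: of_nat_power)
    then have "coeff ?f d ^ 2 =
        coeff ?g d ^ 2 + of_nat (p\<^sup>2) * (coeff U d + of_nat p * coeff V d) ^ 2"
      using g[OF False] unfolding of_nat_power by algebra
    then show ?thesis by blast
  qed
  then obtain w where w: "\<And>d. coeff ?f d ^ 2 = coeff ?g d ^ 2 + of_nat (p\<^sup>2) * w d"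
    by metis
  have "(\<Sum>d\<le>n. fps_X ^ d * coeff ?f d ^ 2) =
      (\<Sum>d\<le>n. fps_X ^ d * coeff ?g d ^ 2) + of_nat (p\<^sup>2) * (\<Sum>d\<le>n. fps_X ^ d * w d)"
    unfolding w distrib_left sum.distrib sum_distrib_left by (simp add: mult.left_commute)
  from arg_cong[OF this, of "\<lambda>f. f $ n"]
  have "int (cphi (p * k) n) = int (if p dvd n then cphi k (n div p) else 0) +
      int (p\<^sup>2) * (\<Sum>d\<le>n. fps_X ^ d * w d) $ n"
    using cphi_generating_function[of 1 n "Suc n" n "p * k"]
      cphi_generating_function[of p n "Suc n" n k] assms
    by (simp add: prime_gt_0_nat fps_of_nat [symmetric] del: of_nat_power)
  then have "[int (cphi (p * k) n) = int (if p dvd n then cphi k (n div p) else 0)] (mod int (p\<^sup>2))"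
    unfolding cong_iff_dvd_diff by simp
  then show ?thesis
    by (simp only: cong_int_iff)
qed

subsection \<open>The finite triple product\<close>

lemma fps_X_power_dvd_iff:
  fixes f :: "'a :: comm_ring_1 fps"
  shows "fps_X ^ n dvd f \<longleftrightarrow> (\<forall>i<n. f $ i = 0)"
proof
  assume "fps_X ^ n dvd f"
  then show "\<forall>i<n. f $ i = 0"
    by (auto simp: fps_X_power_mult_nth elim!: dvdE)
next
  assume "\<forall>i<n. f $ i = 0"
  then have "f = fps_X ^ n * fps_shift n f"
    by (intro fps_ext) (simp add: fps_X_power_mult_nth)
  then show "fps_X ^ n dvd f"
    by (rule dvdI)
qed

text \<open>A series with constant term 1 is a unit; this cancels Euler products in congruences
  modulo q^n.\<close>

lemma fps_X_power_dvd_mult_cancel: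
  fixes u f :: "'a :: comm_ring_1 fps"
  assumes "u $ 0 = 1" "fps_X ^ n dvd u * f"
  shows "fps_X ^ n dvd f"
  unfolding fps_X_power_dvd_iff
proof (intro allI impI)
  fix i assume "i < n"
  then show "f $ i = 0"
  proof (induction i rule: less_induct)
    case (less i)
    have "0 = (u * f) $ i"
      using assms(2) less.prems by (simp add: fps_X_power_dvd_iff)
    also have "\<dots> = f $ i + (\<Sum>j\<in>{0<..i}. u $ j * f $ (i - j))"
      unfolding fps_mult_nth by (subst sum.head) (simp_all add: assms(1))
    also have "(\<Sum>j\<in>{0<..i}. u $ j * f $ (i - j)) = 0"
      using less by (intro sum.neutral) auto
    finally show ?case by simp
  qed
qed

definition euler_prod :: "nat \<Rightarrow> int fps" where
  "euler_prod n = (\<Prod>i<n. 1 - fps_X ^ Suc i)"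

lemma euler_prod_Suc: "euler_prod (Suc n) = euler_prod n * (1 - fps_X ^ Suc n)"
  by (simp add: euler_prod_def)

lemma euler_prod_nth_0: "euler_prod n $ 0 = 1"
  by (induction n) (simp_all add: euler_prod_Suc, simp add: euler_prod_def)

lemma euler_prod_diff_dvd: "m \<le> n \<Longrightarrow> fps_X ^ Suc m dvd euler_prod n - euler_prod m"
proof (induction n rule: dec_induct)
  case (step n)
  have "euler_prod (Suc n) - euler_prod m =
      (euler_prod n - euler_prod m) - fps_X ^ Suc n * euler_prod n"
    by (simp add: euler_prod_Suc algebra_simps)
  moreover have "fps_X ^ Suc m dvd fps_X ^ Suc n * euler_prod n"
    using step.hyps by (intro dvd_mult2 le_imp_power_dvd) simp
  ultimately show ?case
    using step.IH dvd_diff by metis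
qed simp

text \<open>Gauss's theorem with denominators cleared: \<open>euler_prod n\<close> is the
  q-Pochhammer symbol (q;q)_n. The induction is the q-Pascal rule, coming from the new factor 1 + z
  q^n.\<close>

lemma q_binomial_theorem:
  assumes "m \<le> n"
  shows "euler_prod m * euler_prod (n - m) * coeff (\<Prod>i<n. [:1, fps_X ^ i:]) m =
         fps_X ^ (m choose 2) * euler_prod n"
  using assms
proof (induction n arbitrary: m)
  case 0
  then show ?case by (simp add: euler_prod_def numeral_2_eq_2)
next
  case (Suc n)
  define b where "b = coeff (\<Prod>i<n. [:1, fps_X ^ i :: int fps:])"
  have deg: "degree (\<Prod>i<n. [:1, fps_X ^ i :: int fps:]) \<le> n"
    using degree_prod_sum_le[of "{..<n}" "\<lambda>i. [:1, fps_X ^ i :: int fps:]"] by simp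
  show ?case
  proof (cases m)
    case 0
    have "coeff (\<Prod>i<k. [:1, fps_X ^ i :: int fps:]) 0 = 1" for k
      by (induction k) (simp_all add: mult.commute)
    with 0 show ?thesis by (simp add: euler_prod_def numeral_2_eq_2)
  next
    case m: (Suc l)
    have l: "l \<le> n" using Suc.prems m by simp
    have rec: "coeff (\<Prod>i<Suc n. [:1, fps_X ^ i:]) m = b m + fps_X ^ n * b l"
      by (simp add: b_def m mult.commute[of _ "[:1, _:]"])
    have IHl: "euler_prod l * euler_prod (n - l) * b l = fps_X ^ (l choose 2) * euler_prod n"
      using Suc.IH[OF l] by (simp add: b_def)
    have X1: "fps_X ^ (m choose 2) = (fps_X ^ (l choose 2) * fps_X ^ l :: int fps)"
      by (simp add: m numeral_2_eq_2 power_add mult.commute)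
    have first: "euler_prod m * euler_prod (n - l) * b m =
        (1 - fps_X ^ (n - l)) * fps_X ^ (m choose 2) * euler_prod n"
    proof (cases "m \<le> n")
      case True
      then have "n - l = Suc (n - m)" using m by simp
      then have "euler_prod (n - l) = euler_prod (n - m) * (1 - fps_X ^ (n - l))"
        by (metis euler_prod_Suc)
      then have "euler_prod m * euler_prod (n - l) * b m =
          (1 - fps_X ^ (n - l)) * (euler_prod m * euler_prod (n - m) * b m)"
        by (simp only: mult_ac)
      also have "euler_prod m * euler_prod (n - m) * b m = fps_X ^ (m choose 2) * euler_prod n"
        using Suc.IH[OF True] by (simp only: b_def)
      finally show ?thesis by (simp only: mult_ac)
    next
      case False
      \<comment> \<open>Here m = n + 1, and the factor \<open>1 - fps_X ^ (n - l)\<close> vanishes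
        as well.\<close>
      then have "n - l = 0" "b m = 0"
        using l m deg by (auto simp: b_def intro: coeff_eq_0)
      then show ?thesis by simp
    qed
    have Xn: "fps_X ^ n = (fps_X ^ l * fps_X ^ (n - l) :: int fps)"
      using l by (simp add: power_add [symmetric])
    have "euler_prod m * euler_prod (Suc n - m) * coeff (\<Prod>i<Suc n. [:1, fps_X ^ i:]) m =
       euler_prod m * euler_prod (n - l) * b m +
         (1 - fps_X ^ m) * fps_X ^ n * (euler_prod l * euler_prod (n - l) * b l)"
      unfolding rec by (simp add: m euler_prod_Suc algebra_simps)
    also have "\<dots> = (1 - fps_X ^ (n - l)) * fps_X ^ (m choose 2) * euler_prod n +
         (1 - fps_X ^ m) * fps_X ^ n * (fps_X ^ (l choose 2) * euler_prod n)"
      unfolding first IHl ..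
    also have "\<dots> = fps_X ^ (m choose 2) * (euler_prod n * (1 - fps_X ^ (n - l) * fps_X ^ m))"
      unfolding X1 Xn by algebra
    also have "fps_X ^ (n - l) * fps_X ^ m = (fps_X ^ Suc n :: int fps)"
      using l by (simp add: m power_add [symmetric])
    finally show ?thesis by (simp only: euler_prod_Suc)
  qed
qed

text \<open>
  \<open>z\<^sup>N\<close> times the truncated theta product \<open>\<Prod>i<N. (1 + z q\<^bsup>i+1\<^esup>) (1 + z\<^sup>-\<^sup>1 q\<^sup>i)\<close>; so the coefficient
  of \<open>z\<^sup>m\<close> has charge \<open>m - N\<close>.
\<close>

definition theta_poly :: "nat \<Rightarrow> int fps poly" where
  "theta_poly N = (\<Prod>i<N. [:1, fps_X ^ Suc i:]) * (\<Prod>i<N. [:fps_X ^ i, 1:])"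

definition triangle :: "nat \<Rightarrow> nat \<Rightarrow> nat" where
  "triangle N m = nat ((int m - int N) * (int m - int N + 1) div 2)"

lemma triangle: "2 * int (triangle N m) = (int m - int N) * (int m - int N + 1)"
proof -
  have "(int m - int N) * (int m - int N + 1) \<ge> 0"
    by (cases "int m - int N \<ge> 0") (auto intro: mult_nonneg_nonneg mult_nonpos_nonpos)
  moreover have "even ((int m - int N) * (int m - int N + 1))"
    by auto
  ultimately show ?thesis
    by (simp add: triangle_def)
qed

lemma int_choose_2: "2 * int (n choose 2) = int n * (int n - 1)"
  by (induction n) (simp_all add: numeral_2_eq_2 algebra_simps)

text \<open>Replacing z by z q^(N-1) merges both products of \<open>theta_poly\<close> into the
  single product of 1 + z q^i for i < 2N, up to a power of q; then the q-binomial theorem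
  applies.\<close>

lemma finite_jacobi_triple_product:
  assumes "m \<le> 2 * N" "N > 0"
  shows "euler_prod m * euler_prod (2 * N - m) * coeff (theta_poly N) m =
         fps_X ^ triangle N m * euler_prod (2 * N)"
proof -
  let ?q = "fps_X :: int fps"
  have shift: "[:?q ^ i, 1:] \<circ>\<^sub>p [:0, ?q ^ (N - 1):] = smult (?q ^ i) [:1, ?q ^ (N - Suc i):]" if "i < N" for i
    using that by (simp add: pcompose_pCons power_add [symmetric])
  have "(\<Prod>i<N. [:?q ^ i, 1:]) \<circ>\<^sub>p [:0, ?q ^ (N - 1):] = (\<Prod>i<N. smult (?q ^ i) [:1, ?q ^ (N - Suc i):])"
    unfolding pcompose_prod by (intro prod.cong refl shift) simp
  also have "\<dots> = smult (\<Prod>i<N. ?q ^ i) (\<Prod>i<N. [:1, ?q ^ (N - Suc i):])"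
    by (rule prod_smult)
  also have "(\<Prod>i<N. ?q ^ i) = ?q ^ (N choose 2)"
    by (induction N) (simp_all add: numeral_2_eq_2 power_add mult.commute)
  also have "(\<Prod>i<N. [:1, ?q ^ (N - Suc i):]) = (\<Prod>i<N. [:1, ?q ^ i:])"
    by (rule prod.nat_diff_reindex)
  finally have low: "(\<Prod>i<N. [:?q ^ i, 1:]) \<circ>\<^sub>p [:0, ?q ^ (N - 1):] =
      smult (?q ^ (N choose 2)) (\<Prod>i<N. [:1, ?q ^ i:])" .
  have high: "(\<Prod>i<N. [:1, ?q ^ Suc i:]) \<circ>\<^sub>p [:0, ?q ^ (N - 1):] = (\<Prod>i<N. [:1, ?q ^ (N + i):])"
    unfolding pcompose_prod using assms(2)
    by (intro prod.cong refl)
      (simp add: pcompose_pCons power_Suc [symmetric] power_add [symmetric] del: power_Suc)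
  have "(\<Prod>i<2 * N. [:1, ?q ^ i:]) = (\<Prod>i<N. [:1, ?q ^ i:]) * (\<Prod>i<N. [:1, ?q ^ (N + i):])"
    using prod.atLeastLessThan_concat[of 0 N "2 * N" "\<lambda>i. [:1, ?q ^ i:]"]
      prod.shift_bounds_nat_ivl[of "\<lambda>i. [:1, ?q ^ i:]" 0 N N]
    by (simp add: lessThan_atLeast0 mult_2 add.commute)
  then have "theta_poly N \<circ>\<^sub>p [:0, ?q ^ (N - 1):] = smult (?q ^ (N choose 2)) (\<Prod>i<2 * N. [:1, ?q ^ i:])"
    unfolding theta_poly_def pcompose_mult low high by (simp add: mult.commute)
  from arg_cong[OF this, of "\<lambda>f. coeff f m"]
  have shifted: "?q ^ ((N - 1) * m) * coeff (theta_poly N) m =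
      ?q ^ (N choose 2) * coeff (\<Prod>i<2 * N. [:1, ?q ^ i:]) m"
    by (simp add: coeff_pcompose_linear power_mult)
  have "?q ^ ((N - 1) * m) * (euler_prod m * euler_prod (2 * N - m) * coeff (theta_poly N) m) =
      euler_prod m * euler_prod (2 * N - m) * (?q ^ ((N - 1) * m) * coeff (theta_poly N) m)"
    by (simp only: mult_ac)
  also have "\<dots> = ?q ^ (N choose 2) *
      (euler_prod m * euler_prod (2 * N - m) * coeff (\<Prod>i<2 * N. [:1, ?q ^ i:]) m)"
    unfolding shifted by (simp only: mult_ac)
  also have "\<dots> = ?q ^ (N choose 2) * ?q ^ (m choose 2) * euler_prod (2 * N)"
    unfolding q_binomial_theorem[OF assms(1)] by (simp only: mult.assoc)
  finally have "?q ^ ((N - 1) * m) * (euler_prod m * euler_prod (2 * N - m) * coeff (theta_poly N) m) =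
      ?q ^ (N choose 2) * ?q ^ (m choose 2) * euler_prod (2 * N)" .
  moreover have exponent: "(N choose 2) + (m choose 2) = (N - 1) * m + triangle N m"
  proof -
    have "2 * int ((N choose 2) + (m choose 2)) = 2 * int ((N - 1) * m + triangle N m)"
      using assms(2) int_choose_2[of N] int_choose_2[of m] triangle[of N m]
      by (cases N) (simp_all add: algebra_simps)
    then show ?thesis by (simp only: mult_cancel_left of_nat_eq_iff) simp
  qed
  ultimately have "?q ^ ((N - 1) * m) * (euler_prod m * euler_prod (2 * N - m) * coeff (theta_poly N) m) =
      ?q ^ ((N - 1) * m) * (?q ^ triangle N m * euler_prod (2 * N))"
    by (simp add: power_add [symmetric] mult.assoc [symmetric])
  then show ?thesis by simp
qed

lemma euler_prod_mult_theta_coeff: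
  assumes "m \<le> 2 * N" "N > 0"
  shows "fps_X ^ N dvd euler_prod N * coeff (theta_poly N) m - fps_X ^ triangle N m"
proof -
  let ?q = "fps_X :: int fps"
  \<comment> \<open>All the Euler products involved agree up to q^W. This is weak for m near either
    end, where the factor q^\<open>triangle N m\<close> makes up for it.\<close>
  define W where "W = min m (2 * N - m)"
  have W: "W \<le> N" "W \<le> 2 * N - W" using assms by (auto simp: W_def)
  have prod_eq: "euler_prod m * euler_prod (2 * N - m) = euler_prod W * euler_prod (2 * N - W)"
    using assms(1) by (auto simp: W_def min_def mult.commute)
  have d: "?q ^ Suc W dvd euler_prod N * euler_prod (2 * N) - euler_prod W * euler_prod (2 * N - W)"
  proof -
    have "euler_prod N * euler_prod (2 * N) - euler_prod W * euler_prod (2 * N - W) =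
        euler_prod N * (euler_prod (2 * N) - euler_prod W) - euler_prod W * (euler_prod (2 * N - W) - euler_prod W) +
        euler_prod W * (euler_prod N - euler_prod W)"
      by algebra
    also have "?q ^ Suc W dvd \<dots>"
      using W by (intro dvd_add dvd_diff dvd_mult euler_prod_diff_dvd) auto
    finally show ?thesis .
  qed
  have exponent: "N \<le> triangle N m + Suc W"
  proof -
    define j where "j = int m - int N"
    have "2 * int (triangle N m) = j * (j + 1)" by (simp add: triangle j_def)
    moreover have "int W = int N - \<bar>j\<bar>" using assms(1) by (auto simp: W_def j_def)
    \<comment> \<open>Just enough, since W = N - |j|.\<close>
    moreover have "j * (j + 1) \<ge> 2 * \<bar>j\<bar> - 2"
    proof (cases "j \<ge> 0")
      case True
      have "j * (j + 1) - (2 * j - 2) = (j - 1) * j + 2" by (simp add: algebra_simps)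
      moreover have "(j - 1) * j \<ge> 0" using True by (cases "j = 0") auto
      ultimately show ?thesis using True by simp
    next
      case False
      have "j * (j + 1) - (- 2 * j - 2) = (j + 1) * (j + 2)" by (simp add: algebra_simps)
      moreover have "(j + 1) * (j + 2) \<ge> 0" using False
        by (cases "j = -1") (auto intro: mult_nonpos_nonpos)
      ultimately show ?thesis using False by simp
    qed
    ultimately show ?thesis by linarith
  qed
  have "euler_prod m * euler_prod (2 * N - m) *
        (euler_prod N * coeff (theta_poly N) m - ?q ^ triangle N m) =
      ?q ^ triangle N m * (euler_prod N * euler_prod (2 * N) - euler_prod W * euler_prod (2 * N - W))"
    unfolding right_diff_distrib prod_eq [symmetric]
    using finite_jacobi_triple_product[OF assms] by (simp add: mult_ac)
  moreover have "?q ^ N dvd \<dots>"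
  proof (rule dvd_trans)
    show "?q ^ N dvd ?q ^ triangle N m * ?q ^ Suc W"
      using le_imp_power_dvd[OF exponent, of ?q] by (simp only: power_add)
  qed (intro mult_dvd_mono dvd_refl d)
  ultimately have "?q ^ N dvd euler_prod m * euler_prod (2 * N - m) *
      (euler_prod N * coeff (theta_poly N) m - ?q ^ triangle N m)"
    by (rule ssubst)
  then show ?thesis
    by (rule fps_X_power_dvd_mult_cancel[rotated]) (simp add: euler_prod_nth_0)
qed

section \<open>Jacobi's cube identity and the theta square modulo q^N\<close>

lemma poly_eq_sum_coeff:
  fixes p :: "'a :: comm_semiring_1 poly"
  assumes "degree p \<le> n"
  shows "poly p x = (\<Sum>i\<le>n. coeff p i * x ^ i)"
  unfolding poly_altdef using assms
  by (intro sum.mono_neutral_left) (auto simp: coeff_eq_0)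

lemma degree_theta_poly: "degree (theta_poly N) \<le> 2 * N"
proof -
  have "degree (\<Prod>i<N. [:1, fps_X ^ Suc i :: int fps:]) \<le> N"
    using degree_prod_sum_le[of "{..<N}" "\<lambda>i. [:1, fps_X ^ Suc i :: int fps:]"] by simp
  moreover have "degree (\<Prod>i<N. [:fps_X ^ i :: int fps, 1:]) \<le> N"
    using degree_prod_sum_le[of "{..<N}" "\<lambda>i. [:fps_X ^ i :: int fps, 1:]"] by simp
  ultimately show ?thesis
    unfolding theta_poly_def by (intro order.trans[OF degree_mult_le]) simp
qed

text \<open>The factor 1 + z of \<open>theta_poly\<close>, from i = 0, vanishes at z = -1, so only
  the term differentiating it survives. The other factors give two Euler products, one of them a
  factor shorter.\<close>

lemma theta_poly_derivative_at_minus_1: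
  assumes "N > 0"
  shows "(\<Sum>m\<le>2 * N. of_nat m * (- 1) ^ (N + m) * coeff (theta_poly N) m) =
         euler_prod N * euler_prod (N - 1)"
proof -
  let ?q = "fps_X :: int fps"
  obtain M where N: "N = Suc M" using assms by (cases N) auto
  define R where "R = (\<Prod>i<N. [:1, ?q ^ Suc i:]) * (\<Prod>i<M. [:?q ^ Suc i, 1:])"
  have "(\<Prod>i<N. [:?q ^ i, 1:]) = [:1, 1:] * (\<Prod>i<M. [:?q ^ Suc i, 1:])"
    unfolding N by (subst prod.lessThan_Suc_shift) (simp only: power_0)
  then have "theta_poly N = [:1, 1:] * R"
    unfolding theta_poly_def R_def by (simp only: mult_ac)
  then have "poly (pderiv (theta_poly N)) (- 1) = poly R (- 1)"
    by (simp add: pderiv_mult pderiv_pCons del: mult_pCons_left)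
  also have "\<dots> = (\<Prod>i<N. 1 - ?q ^ Suc i) * (\<Prod>i<M. - (1 - ?q ^ Suc i))"
    by (simp add: R_def poly_prod)
  also have "(\<Prod>i<M. - (1 - ?q ^ Suc i)) = (- 1) ^ M * euler_prod M"
    by (subst prod_uminus) (simp add: euler_prod_def)
  finally have "poly (pderiv (theta_poly N)) (- 1) = (- 1) ^ M * (euler_prod N * euler_prod M)"
    by (simp add: euler_prod_def mult_ac)
  moreover have "poly (pderiv (theta_poly N)) (- 1) =
      (\<Sum>m<2 * N. of_nat (Suc m) * coeff (theta_poly N) (Suc m) * (- 1) ^ m)"
  proof (subst poly_eq_sum_coeff)
    show "degree (pderiv (theta_poly N)) \<le> 2 * N - 1"
      using degree_theta_poly[of N]
      by (intro degree_le) (auto simp: coeff_pderiv intro!: coeff_eq_0)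
  qed (simp add: coeff_pderiv N lessThan_Suc_atMost)
  ultimately have "euler_prod N * euler_prod M =
      (- 1) ^ M * (\<Sum>m<2 * N. of_nat (Suc m) * coeff (theta_poly N) (Suc m) * (- 1) ^ m)"
    by (simp add: mult.assoc [symmetric] power_add [symmetric])
  also have "\<dots> = (\<Sum>m<2 * N. of_nat (Suc m) * (- 1) ^ (N + Suc m) * coeff (theta_poly N) (Suc m))"
    unfolding sum_distrib_left by (intro sum.cong refl) (simp add: N power_add mult_ac)
  also have "\<dots> = (\<Sum>m\<le>2 * N. of_nat m * (- 1) ^ (N + m) * coeff (theta_poly N) m)"
    by (subst sum.atMost_shift) simp
  finally show ?thesis by (simp add: N)
qed

text \<open>With j = m - N, the terms for j and -1-j share an exponent and have opposite signs;
  merging their weights m would give the usual 2j + 1.\<close>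

lemma jacobi_cube_identity_mod:
  assumes "N > 0"
  shows "fps_X ^ N dvd euler_prod N ^ 3 -
           (\<Sum>m\<le>2 * N. of_nat m * (- 1) ^ (N + m) * fps_X ^ triangle N m)"
proof -
  let ?q = "fps_X :: int fps" and ?E = "euler_prod N"
  have "?q ^ N dvd ?E - euler_prod (N - 1)"
    using euler_prod_diff_dvd[of "N - 1" N] assms by simp
  then have "?q ^ N dvd ?E ^ 2 * (?E - euler_prod (N - 1))"
    by (rule dvd_mult)
  moreover have "?q ^ N dvd (\<Sum>m\<le>2 * N. of_nat m * (- 1) ^ (N + m) *
        (?E * coeff (theta_poly N) m - ?q ^ triangle N m))"
    using assms by (intro dvd_sum dvd_mult euler_prod_mult_theta_coeff) auto
  moreover have "(\<Sum>m\<le>2 * N. of_nat m * (- 1) ^ (N + m) *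
        (?E * coeff (theta_poly N) m - ?q ^ triangle N m)) =
      ?E * (\<Sum>m\<le>2 * N. of_nat m * (- 1) ^ (N + m) * coeff (theta_poly N) m) -
      (\<Sum>m\<le>2 * N. of_nat m * (- 1) ^ (N + m) * ?q ^ triangle N m)"
    by (simp add: right_diff_distrib sum_subtractf sum_distrib_left mult_ac)
  ultimately have "?q ^ N dvd ?E ^ 2 * (?E - euler_prod (N - 1)) + (?E * (?E * euler_prod (N - 1)) -
      (\<Sum>m\<le>2 * N. of_nat m * (- 1) ^ (N + m) * ?q ^ triangle N m))"
    unfolding theta_poly_derivative_at_minus_1[OF assms] by simp
  then show ?thesis
    by (simp add: power2_eq_square power3_eq_cube algebra_simps)
qed

text \<open>The middle coefficient pairs opposite charges y and -y, whose exponents add up to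
  y^2.\<close>

lemma euler_prod_square_mult_theta_square:
  assumes "N > 0"
  shows "fps_X ^ N dvd euler_prod N ^ 2 * coeff (theta_poly N ^ 2) (2 * N) -
           (\<Sum>a\<le>2 * N. fps_X ^ (triangle N a + triangle N (2 * N - a)))"
proof -
  let ?q = "fps_X :: int fps" and ?E = "euler_prod N" and ?G = "coeff (theta_poly N)"
  have "?q ^ N dvd (?E * ?G a) * (?E * ?G (2 * N - a)) - ?q ^ triangle N a * ?q ^ triangle N (2 * N - a)"
    if "a \<le> 2 * N" for a
  proof -
    have "(?E * ?G a) * (?E * ?G (2 * N - a)) - ?q ^ triangle N a * ?q ^ triangle N (2 * N - a) =
       ?E * ?G a * (?E * ?G (2 * N - a) - ?q ^ triangle N (2 * N - a)) +
       ?q ^ triangle N (2 * N - a) * (?E * ?G a - ?q ^ triangle N a)"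
      by (simp add: algebra_simps)
    also have "?q ^ N dvd \<dots>"
      using that assms by (intro dvd_add dvd_mult euler_prod_mult_theta_coeff) auto
    finally show ?thesis .
  qed
  then have "?q ^ N dvd (\<Sum>a\<le>2 * N. (?E * ?G a) * (?E * ?G (2 * N - a)) -
      ?q ^ triangle N a * ?q ^ triangle N (2 * N - a))"
    by (intro dvd_sum) auto
  then show ?thesis
    by (simp add: power2_eq_square coeff_mult sum_subtractf sum_distrib_left power_add mult_ac)
qed

text \<open>\<open>theta_poly N\<close> is B(zq) times the reversal of B. The middle coefficient of
  its square thus matches equal degrees of B^2, and the argument zq supplies
  \<open>fps_X ^ d\<close>.\<close>

lemma theta_square_eq_row_gf:
  "coeff (theta_poly N ^ 2) (2 * N) = (\<Sum>d\<le>2 * N. fps_X ^ d * coeff (row_gf 1 N 2) d ^ 2)"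
proof -
  let ?q = "fps_X :: int fps"
  define B where "B = (\<Prod>i<N. [:1, ?q ^ i:])"
  have row: "row_gf 1 N 2 = B ^ 2"
    by (simp add: row_gf_def B_def prod_power_distrib monom_altdef one_pCons)
  have deg: "degree (B ^ 2) = 2 * N"
    unfolding B_def by (simp add: degree_power_eq degree_prod_eq_sum_degree)
  have "reflect_poly B = (\<Prod>i<N. [:?q ^ i, 1:])"
    unfolding B_def reflect_poly_prod by (simp add: reflect_poly_pCons)
  moreover have "B \<circ>\<^sub>p [:0, ?q:] = (\<Prod>i<N. [:1, ?q ^ Suc i:])"
    unfolding B_def pcompose_prod by (simp add: pcompose_pCons mult.commute)
  ultimately have "theta_poly N ^ 2 = (B ^ 2 \<circ>\<^sub>p [:0, ?q:]) * reflect_poly (B ^ 2)"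
    by (simp add: theta_poly_def reflect_poly_mult pcompose_mult power2_eq_square mult_ac)
  then have "coeff (theta_poly N ^ 2) (2 * N) =
      (\<Sum>d\<le>2 * N. ?q ^ d * coeff (B ^ 2) d * coeff (B ^ 2) d)"
    unfolding \<open>theta_poly N ^ 2 = _\<close> coeff_mult coeff_reflect_poly deg coeff_pcompose_linear
    by (intro sum.cong) auto
  then show ?thesis
    unfolding row by (simp add: power2_eq_square mult.assoc)
qed

subsection \<open>Two colours modulo 5\<close>

text \<open>The derivative of f^p is p f' f^(p-1), so p divides i times the coefficient at
  i.\<close>

lemma prime_dvd_fps_power_nth:
  fixes f :: "int fps"
  assumes "prime p" "\<not> p dvd i"
  shows "int p dvd (f ^ p) $ i"
proof (cases i)
  case 0
  then show ?thesis using assms by simp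
next
  case (Suc j)
  have "int i * (f ^ p) $ i = fps_deriv (f ^ p) $ j"
    by (simp add: Suc)
  also have "\<dots> = int p * (fps_deriv f * f ^ (p - 1)) $ j"
    by (simp add: fps_deriv_power mult.assoc)
  finally have "int p dvd int i * (f ^ p) $ i"
    by simp
  then show ?thesis
    using assms by (simp add: prime_dvd_mult_iff)
qed

text \<open>Modulo 5, -8 is 2, a quadratic non-residue.\<close>

lemma int_dvd_5_of_quadratic:
  fixes x y :: int
  assumes "5 dvd x\<^sup>2 + 8 * y\<^sup>2"
  shows "5 dvd x"
proof -
  define a b where "a = x mod 5" and "b = y mod 5"
  have "(x\<^sup>2 + 8 * y\<^sup>2) mod 5 = (a\<^sup>2 + 8 * b\<^sup>2) mod 5"
    unfolding a_def b_def
    by (intro mod_add_cong)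
      (simp_all only: power_mod mod_mult_right_eq mod_mod_trivial, metis mod_mult_right_eq power_mod)
  then have "(a\<^sup>2 + 8 * b\<^sup>2) mod 5 = 0"
    using assms by (simp only: dvd_eq_mod_eq_0)
  moreover have "a \<in> {0, 1, 2, 3, 4}" "b \<in> {0, 1, 2, 3, 4}"
    unfolding a_def b_def by auto
  ultimately have "a = 0"
    by auto
  then show ?thesis
    by (simp add: a_def dvd_eq_mod_eq_0)
qed

lemma five_dvd_cphi_2: "5 dvd cphi 2 (5 * n + 3)"
proof -
  \<comment> \<open>\<open>N \<equiv> 3 (mod 5)\<close> makes \<open>2 (m - N) + 1\<close> congruent to \<open>2 m\<close>, so the coefficient \<open>m\<close> in \<open>J\<close>
    is the quantity forced to vanish; an untruncated argument would pair \<open>m\<close> with its mirror image.\<close>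
  define N where "N = 5 * n + 8"
  let ?q = "fps_X :: int fps" and ?E = "euler_prod N"
  define C where "C = coeff (theta_poly N ^ 2) (2 * N)"
  define J where "J = (\<Sum>m\<le>2 * N. of_nat m * (- 1) ^ (N + m) * ?q ^ triangle N m)"
  define P where "P = (\<Sum>a\<le>2 * N. ?q ^ (triangle N a + triangle N (2 * N - a)))"
  have N: "N > 0" by (simp add: N_def)
  \<comment> \<open>Split E^5 C as E^3 times E^2 C: modulo q^N the first factor is J and the second
    is P.\<close>
  have "?E ^ 5 * C - J * P = ?E\<^sup>2 * C * (?E ^ 3 - J) + J * (?E\<^sup>2 * C - P)"
    by algebra
  also have "?q ^ N dvd \<dots>"
    using jacobi_cube_identity_mod[OF N] euler_prod_square_mult_theta_square[OF N]
    unfolding J_def P_def C_def by (intro dvd_add dvd_mult)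
  finally have EC: "(?E ^ 5 * C) $ i = (J * P) $ i" if "i < N" for i
    using that by (simp add: fps_X_power_dvd_iff)
  have JP: "5 dvd (J * P) $ i" if "i mod 5 = 3" for i
  proof -
    have c: "of_nat m * (- 1) ^ (N + m) = fps_const (int m * (- 1) ^ (N + m))" for m
      by (cases "even (N + m)") (simp_all add: fps_of_nat [symmetric])
    have "J * P = (\<Sum>m\<le>2 * N. \<Sum>a\<le>2 * N. fps_const (int m * (- 1) ^ (N + m)) *
        ?q ^ (triangle N m + (triangle N a + triangle N (2 * N - a))))"
      unfolding J_def P_def sum_product c by (intro sum.cong refl) (simp add: power_add mult_ac)
    then have "(J * P) $ i = (\<Sum>m\<le>2 * N. \<Sum>a\<le>2 * N. int m * (- 1) ^ (N + m) *
        (if i = triangle N m + (triangle N a + triangle N (2 * N - a)) then 1 else 0))"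
      by (simp add: fps_sum_nth)
    also have "5 dvd \<dots>"
    proof (intro dvd_sum)
      fix m a assume a: "a \<in> {..2 * N}"
      show "5 dvd int m * (- 1) ^ (N + m) *
        (if i = triangle N m + (triangle N a + triangle N (2 * N - a)) then 1 else 0)"
      proof (cases "i = triangle N m + (triangle N a + triangle N (2 * N - a))")
        case True
        define x y where "x = 2 * (int m - int N) + 1" and "y = int a - int N"
        have "8 * int i + 1 = x\<^sup>2 + 8 * y\<^sup>2"
          using a triangle[of N m] triangle[of N a] triangle[of N "2 * N - a"] unfolding True x_def y_def
          by (simp add: of_nat_diff power2_eq_square algebra_simps)
        moreover have "5 dvd 8 * int i + 1"
          using that by presburger
        ultimately have "5 dvd x"
          by (metis int_dvd_5_of_quadratic)
        then have "5 dvd int m"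
          unfolding x_def N_def by presburger
        then show ?thesis by simp
      qed simp
    qed
    finally show ?thesis .
  qed
  \<comment> \<open>Modulo 5 only j divisible by 5 contribute to the convolution with E^5, and i - j
    stays in the residue class 3; the term j = 0 isolates \<open>C $ i\<close>.\<close>
  have "5 dvd C $ i" if "i < N" "i mod 5 = 3" for i
    using that
  proof (induction i rule: less_induct)
    case (less i)
    have "(?E ^ 5 * C) $ i = C $ i + (\<Sum>j\<in>{0<..i}. (?E ^ 5) $ j * C $ (i - j))"
      unfolding fps_mult_nth by (subst sum.head) (simp_all add: euler_prod_nth_0 fps_power_zeroth)
    moreover have "5 dvd (\<Sum>j\<in>{0<..i}. (?E ^ 5) $ j * C $ (i - j))"
    proof (intro dvd_sum)
      fix j assume j: "j \<in> {0<..i}"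
      show "5 dvd (?E ^ 5) $ j * C $ (i - j)"
      proof (cases "5 dvd j")
        case True
        then obtain c where "j = 5 * c" ..
        then have "i = (i - j) + 5 * c" using j by simp
        then have "(i - j) mod 5 = 3" using less.prems(2) by (metis mod_mult_self2)
        then show ?thesis
          using j less by (intro dvd_mult less.IH) auto
      next
        case False
        then show ?thesis
          using prime_dvd_fps_power_nth[of 5 j ?E] by simp
      qed
    qed
    ultimately show ?case
      using JP[OF less.prems(2)] EC[OF less.prems(1)] by (metis dvd_add_left_iff)
  qed
  moreover have "C $ (5 * n + 3) = int (cphi 2 (5 * n + 3))"
    using cphi_generating_function[of 1 "5 * n + 3" N "2 * N" 2]
    unfolding C_def theta_square_eq_row_gf by (simp add: N_def)
  ultimately have "5 dvd int (cphi 2 (5 * n + 3))"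
    by (simp add: N_def flip: \<open>C $ _ = _\<close>)
  then show ?thesis by presburger
qed

theorem theorem6p6:
  fixes n :: nat
  shows "[cphi 10 (2 * n + 1) = 0] (mod 4) \<and>
         (\<forall>r \<in> {1..4}. [cphi 10 (5 * n + r) = 0] (mod 5\<^sup>2)) \<and>
         [cphi 10 (25 * n + 15) = 0] (mod 5)"
proof (intro conjI ballI)
  show "[cphi 10 (2 * n + 1) = 0] (mod 4)"
    \<comment> \<open>Ten is read as 2 * 5 with p = 2 here, and as 5 * 2 with p = 5 below.\<close>
    using cphi_prime_mult_cong[of 2 5 "2 * n + 1"] by simp
  show "[cphi 10 (5 * n + r) = 0] (mod 5\<^sup>2)" if "r \<in> {1..4}" for r
  proof -
    have "\<not> 5 dvd 5 * n + r" using that by auto presburger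
    then show ?thesis
      using cphi_prime_mult_cong[of 5 2 "5 * n + r"] by simp
  qed
  have "[cphi 10 (25 * n + 15) = cphi 2 (5 * n + 3)] (mod 5\<^sup>2)"
  proof -
    have eq: "25 * n + 15 = 5 * (5 * n + 3)" by simp
    show ?thesis
      using cphi_prime_mult_cong[of 5 2 "25 * n + 15"] unfolding eq by simp
  qed
  then have "[cphi 10 (25 * n + 15) = cphi 2 (5 * n + 3)] (mod 5)"
    by (rule cong_dvd_modulus_nat) simp
  then show "[cphi 10 (25 * n + 15) = 0] (mod 5)"
    using five_dvd_cphi_2[of n] by (meson cong_0_iff cong_trans)
qed

end
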